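(* Let $L\ge 2$ and $d\ge 1$ be integers, and let $x_0,\dots,x_{L-1}\in\mathbb{R}^d$ be pairwise distinct templates, all having the same Euclidean norm. Let $n_0,\dots,n_{M-1}$ be i.i.d. $\mathcal{N}(0,I_{d\times d})$ random vectors, and let $\hat{x}_0,\dots,\hat{x}_{L-1}$ denote the output of either the hard-assignment algorithm or the soft-assignment algorithm (both defined in the context) applied to these templates and observations. 1. (Non-vanishing estimators.) For every $0\le \ell\le L-1$, $\lim_{M\to\infty}\hat{x}_\ell\neq 0$ almost surely. 2. (Positive correlation.) For every $0\le \ell\le L-1$, $\lim_{M\to\infty}\mathbb{E}[\langle \hat{x}_\ell,x_\ell\rangle]>0$. 3. (Consistency, hard-assignment only.) If $\hat{x}_0,\dots,\hat{x}_{L-1}$ is the output of the hard-assignment algorithm, then for every $\ell$ and every $k\neq \ell$, $\lim_{M\to\infty}\mathbb{E}[\langle \hat{x}_\ell,x_\ell\rangle]>\lim_{M\to\infty}\mathbb{E}[\langle \hat{x}_\ell,x_k\rangle]$.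
   Context: Hard-assignment algorithm: for each $i=0,\dots,M-1$ let $\hat{R}_i=\arg\max_{0\le \ell\le L-1}\langle n_i,x_\ell\rangle$ (almost surely unique), let $\mathcal{A}_\ell=\{n_i:\hat{R}_i=\ell\}$, and set $\hat{x}_\ell=\frac{1}{|\mathcal{A}_\ell|}\sum_{n_i\in\mathcal{A}_\ell}n_i$. Soft-assignment algorithm (one EM iteration): set $p_i^{(\ell)}=\frac{\exp(\langle n_i,x_\ell\rangle)}{\sum_{r=0}^{L-1}\exp(\langle n_i,x_r\rangle)}$ and $\hat{x}_\ell=\frac{\sum_{i=0}^{M-1}p_i^{(\ell)}n_i}{\sum_{i=0}^{M-1}p_i^{(\ell)}}$. *)

theory Defs
  imports "HOL-Probability.Probability"
begin

definition std_gauss_density :: "'v::euclidean_space \<Rightarrow> ennreal" where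
  "std_gauss_density v =
     ennreal ((2 * pi) powr (- real DIM('v) / 2) * exp (- (norm v)\<^sup>2 / 2))"

definition assigned :: "(nat \<Rightarrow> 'v::euclidean_space) \<Rightarrow> nat \<Rightarrow> 'v \<Rightarrow> nat \<Rightarrow> bool" where
  "assigned x L v l \<longleftrightarrow> l < L \<and> (\<forall>r<L. r \<noteq> l \<longrightarrow> inner v (x r) < inner v (x l))"

definition hard_est :: "(nat \<Rightarrow> 'v::euclidean_space) \<Rightarrow> nat \<Rightarrow> (nat \<Rightarrow> 'v) \<Rightarrow> nat \<Rightarrow> nat \<Rightarrow> 'v" where
  "hard_est x L ns M l =
     (let A = {i. i < M \<and> assigned x L (ns i) l}
      in (1 / real (card A)) *\<^sub>R (\<Sum>i\<in>A. ns i))"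

text \<open>Soft-assignment estimator (one EM iteration) computed from the first M observations.\<close>
definition soft_weight :: "(nat \<Rightarrow> 'v::euclidean_space) \<Rightarrow> nat \<Rightarrow> 'v \<Rightarrow> nat \<Rightarrow> real" where
  "soft_weight x L v l = exp (inner v (x l)) / (\<Sum>r<L. exp (inner v (x r)))"

definition soft_est :: "(nat \<Rightarrow> 'v::euclidean_space) \<Rightarrow> nat \<Rightarrow> (nat \<Rightarrow> 'v) \<Rightarrow> nat \<Rightarrow> nat \<Rightarrow> 'v" where
  "soft_est x L ns M l =
     (1 / (\<Sum>i<M. soft_weight x L (ns i) l)) *\<^sub>R (\<Sum>i<M. soft_weight x L (ns i) l *\<^sub>R ns i)"

end

theory Submission
  imports Defs "HOL-Library.Discrete_Functions"
begin

text \<open>Both estimators are weighted means of the observations with weights \<open>w (n i) \<in> [0, 1]\<close>: the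
  indicator of the cell of \<open>x l\<close>, respectively the softmax weight. By the law of large numbers they
  converge to \<open>E[w(X) X] / E[w(X)]\<close>; convergence of the expectations follows from an \<open>L\<^sup>1\<close> estimate
  of order \<open>1 / sqrt m\<close>, in which the event of small total weight is handled by Chebyshev's
  inequality and fourth moments. Since the templates have equal norms, \<open>w\<close> is nondecreasing along
  the direction \<open>x l\<close>, and strictly larger at points near \<open>x l\<close> than at their mirror images.
  The reflection along \<open>x l\<close> preserves the Gaussian measure, so that
  \<open>E[w(X) (X \<bullet> x l)] > 0\<close>. On the cell of \<open>x l\<close> one has \<open>v \<bullet> x l > v \<bullet> x k\<close>,
  which gives the strict inequality of the third claim.\<close>

section \<open>Invariance of Lebesgue measure under translations and orthogonal maps\<close>

lemma nn_integral_lborel_translate: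
  fixes h :: "'v::euclidean_space \<Rightarrow> ennreal"
  assumes [measurable]: "h \<in> borel_measurable borel"
  shows "(\<integral>\<^sup>+x. h (x + a) \<partial>lborel) = (\<integral>\<^sup>+x. h x \<partial>lborel)"
proof -
  have "(\<integral>\<^sup>+x. h x \<partial>lborel) = (\<integral>\<^sup>+x. h x \<partial>distr lborel borel ((+) a))"
    by (simp only: lborel_distr_plus)
  also have "\<dots> = (\<integral>\<^sup>+x. h (a + x) \<partial>lborel)"
    by (rule nn_integral_distr) auto
  finally show ?thesis
    by (simp add: add.commute)
qed

text \<open>Uniqueness of translation-invariant functionals: both sides are invariant under translating \<open>h\<close>,
  and they are compared by applying Tonelli twice to \<open>h (f x) * G y\<close> for a radial \<open>G\<close>.\<close>

lemma nn_integral_lborel_orthogonal: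
  fixes f :: "'v::euclidean_space \<Rightarrow> 'v" and h :: "'v \<Rightarrow> ennreal"
  assumes f: "orthogonal_transformation f" and h [measurable]: "h \<in> borel_measurable borel"
  shows "(\<integral>\<^sup>+x. h (f x) \<partial>lborel) = (\<integral>\<^sup>+x. h x \<partial>lborel)"
proof -
  define G :: "'v \<Rightarrow> ennreal" where "G = indicator (cball 0 1)"
  have [measurable]: "G \<in> borel_measurable borel"
    unfolding G_def by (intro borel_measurable_indicator) simp
  have lin: "linear f"
    using f by (rule orthogonal_transformation_linear)
  then have [measurable]: "f \<in> borel_measurable borel"
    by (simp add: linear_continuous_on linear_linear borel_measurable_continuous_onI)
  have G: "G (- f x) = G x" for x
    using orthogonal_transformation_norm[OF f] by (simp add: G_def indicator_def)
  obtain g where g: "\<And>y. f (g y) = y"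
    using orthogonal_transformation_surj[OF f] by (metis surjD)
  let ?c = "\<integral>\<^sup>+y. G y \<partial>(lborel :: 'v measure)"
  have "(\<integral>\<^sup>+x. h (f x) \<partial>lborel) * ?c = (\<integral>\<^sup>+x. \<integral>\<^sup>+y. h (f x) * G y \<partial>lborel \<partial>lborel)"
    by (simp add: nn_integral_cmult nn_integral_multc)
  also have "\<dots> = (\<integral>\<^sup>+x. \<integral>\<^sup>+y. h (f x) * G (y + (- f x)) \<partial>lborel \<partial>lborel)"
    by (subst nn_integral_lborel_translate) auto
  also have "\<dots> = (\<integral>\<^sup>+y. \<integral>\<^sup>+x. h (f x) * G (y + (- f x)) \<partial>lborel \<partial>lborel)"
    by (rule lborel_pair.Fubini') measurable
  \<comment> \<open>Shifting \<open>x\<close> by a preimage \<open>g y\<close> of \<open>y\<close>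
    turns \<open>f x\<close> into \<open>y + f x\<close>, while the argument of \<open>G\<close>
    collapses to \<open>- f x\<close>. Radiality of \<open>G\<close> then makes the weight depend on
    \<open>x\<close> alone, which is what lets the second exchange of integrals separate
    \<open>h\<close> from \<open>G\<close>.\<close>
  also have "\<dots> = (\<integral>\<^sup>+y. \<integral>\<^sup>+x. h (f (x + g y)) * G (y + (- f (x + g y))) \<partial>lborel \<partial>lborel)"
    by (intro nn_integral_cong nn_integral_lborel_translate[symmetric]) measurable
  also have "\<dots> = (\<integral>\<^sup>+y. \<integral>\<^sup>+x. h (y + f x) * G x \<partial>lborel \<partial>lborel)"
    by (simp add: linear_add[OF lin] g G add.commute)
  also have "\<dots> = (\<integral>\<^sup>+x. \<integral>\<^sup>+y. h (y + f x) * G x \<partial>lborel \<partial>lborel)"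
    by (rule lborel_pair.Fubini') measurable
  also have "\<dots> = (\<integral>\<^sup>+x. h x \<partial>lborel) * ?c"
    by (simp add: nn_integral_cmult nn_integral_multc nn_integral_lborel_translate)
  finally have *: "(\<integral>\<^sup>+x. h (f x) \<partial>lborel) * ?c = (\<integral>\<^sup>+x. h x \<partial>lborel) * ?c" .
  have c: "?c = emeasure lborel (cball (0::'v) 1)"
    by (simp add: G_def)
  have "?c \<noteq> \<infinity>"
    using emeasure_bounded_finite[of "cball (0::'v) 1"] unfolding c by auto
  moreover have "?c \<noteq> 0"
    unfolding c using less_imp_neq[OF unit_ball_vol_pos[of "real DIM('v)"]] by (simp add: emeasure_cball)
  ultimately show ?thesis
    using * ennreal_mult_cancel_left[of ?c] by (simp add: mult.commute)
qed

lemma open_AE_lborel_nonempty: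
  fixes U :: "'v::euclidean_space set"
  assumes "open U" "AE v in lborel. v \<notin> U"
  shows "U = {}"
proof -
  have "U \<in> null_sets lborel"
    using assms by (simp add: AE_iff_null_sets)
  then show ?thesis
    using open_not_negligible[OF assms(1)] null_sets_completionI negligible_iff_null_sets by blast
qed

section \<open>The standard Gaussian measure: orthogonal invariance and fourth moments\<close>

definition gauss :: "'v::euclidean_space measure" where
  "gauss = density lborel std_gauss_density"

lemma measurable_std_gauss_density [measurable]:
  "(std_gauss_density :: 'v::euclidean_space \<Rightarrow> ennreal) \<in> borel_measurable borel"
  unfolding std_gauss_density_def[abs_def] by measurable

lemma sets_gauss [measurable_cong, simp]: "sets gauss = sets borel"
  by (simp add: gauss_def)

lemma space_gauss [simp]: "space gauss = UNIV"
  by (simp add: gauss_def)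

text \<open>The density depends only on the norm, which \<open>f\<close> preserves, so the claim
  reduces to the invariance of Lebesgue measure.\<close>

lemma distr_gauss_orthogonal:
  fixes f :: "'v::euclidean_space \<Rightarrow> 'v"
  assumes f: "orthogonal_transformation f"
  shows "distr gauss borel f = gauss"
proof (rule measure_eqI)
  have lin: "linear f"
    using f by (rule orthogonal_transformation_linear)
  then have [measurable]: "f \<in> borel_measurable borel"
    by (simp add: linear_continuous_on linear_linear borel_measurable_continuous_onI)
  fix A assume "A \<in> sets (distr gauss borel f)"
  then have [measurable]: "A \<in> sets borel"
    by simp
  have "emeasure (distr gauss borel f) A = (\<integral>\<^sup>+v. indicator A (f v) \<partial>gauss)"
    using nn_integral_distr[of f gauss borel "indicator A"] by simp
  also have "\<dots> = (\<integral>\<^sup>+v. std_gauss_density v * indicator A (f v) \<partial>lborel)"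
    unfolding gauss_def by (rule nn_integral_density) measurable
  also have "\<dots> = (\<integral>\<^sup>+v. std_gauss_density (f v) * indicator A (f v) \<partial>lborel)"
    using orthogonal_transformation_norm[OF f] by (simp add: std_gauss_density_def)
  also have "\<dots> = (\<integral>\<^sup>+v. std_gauss_density v * indicator A v \<partial>lborel)"
    by (rule nn_integral_lborel_orthogonal[OF f]) measurable
  also have "\<dots> = emeasure gauss A"
    by (simp add: gauss_def emeasure_density)
  finally show "emeasure (distr gauss borel f) A = emeasure gauss A" .
qed simp

lemma nn_integral_lborel_scaleR:
  fixes h :: "'v::euclidean_space \<Rightarrow> ennreal"
  assumes [measurable]: "h \<in> borel_measurable borel" and c: "c \<noteq> 0"
  shows "(\<integral>\<^sup>+x. h x \<partial>lborel) = ennreal (\<bar>c\<bar> ^ DIM('v)) * (\<integral>\<^sup>+x. h (c *\<^sub>R x) \<partial>lborel)"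
  by (subst lborel_affine[OF c, of 0])
     (simp add: nn_integral_density nn_integral_distr nn_integral_cmult)

text \<open>Half of the Gaussian exponent absorbs the factor \<open>norm v ^ 4\<close>; what remains
  is the Gaussian integrand evaluated at \<open>v / sqrt 2\<close>, whose integral is finite by
  scaling. Finiteness of the Gaussian mass enters through the hypothesis, which is later supplied by
  the law of the observations.\<close>

lemma integrable_gauss_norm_power4:
  assumes "prob_space (gauss :: 'v::euclidean_space measure)"
  shows "integrable gauss (\<lambda>v::'v. norm v ^ 4)"
proof -
  interpret prob_space "gauss :: 'v measure" by fact
  define C where "C = (2 * pi) powr (- real DIM('v) / 2)"
  define I where "I = (\<integral>\<^sup>+v. ennreal (C * exp (- (norm v)\<^sup>2 / 2)) \<partial>(lborel::'v measure))"
  have C: "C > 0" unfolding C_def by simp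
  have dens: "std_gauss_density = (\<lambda>v::'v. ennreal (C * exp (- (norm v)\<^sup>2 / 2)))"
    by (simp add: std_gauss_density_def C_def fun_eq_iff)
  have I: "I < \<infinity>"
  proof -
    have "I = emeasure (gauss :: 'v measure) UNIV"
      unfolding I_def gauss_def dens by (subst emeasure_density) auto
    then show ?thesis using emeasure_space_1 by simp
  qed
  \<comment> \<open>The constant 32 comes from \<open>t\<^sup>2 / 2 \<le> exp t\<close> at
    \<open>t = (norm v)\<^sup>2 / 4\<close>.\<close>
  have le: "C * exp (- (norm v)\<^sup>2 / 2) * norm v ^ 4 \<le> 32 * (C * exp (- (norm ((1 / sqrt 2) *\<^sub>R v))\<^sup>2 / 2))" for v :: 'v
  proof -
    have "((norm v)\<^sup>2 / 4)\<^sup>2 / 2 \<le> exp ((norm v)\<^sup>2 / 4)"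
      using exp_lower_Taylor_quadratic[of "(norm v)\<^sup>2 / 4"] by (smt (verit) zero_le_power2 divide_nonneg_nonneg)
    then have "norm v ^ 4 \<le> 32 * exp ((norm v)\<^sup>2 / 4)"
      by (simp add: power2_eq_square field_simps power4_eq_xxxx)
    then have "exp (- (norm v)\<^sup>2 / 2) * norm v ^ 4 \<le> exp (- (norm v)\<^sup>2 / 2) * (32 * exp ((norm v)\<^sup>2 / 4))"
      by (intro mult_left_mono) auto
    also have "\<dots> = 32 * exp (- (norm v)\<^sup>2 / 4)"
      by (simp add: exp_add[symmetric])
    also have "- (norm v)\<^sup>2 / 4 = - (norm ((1 / sqrt 2) *\<^sub>R v))\<^sup>2 / 2"
      by (simp add: power_divide)
    finally show ?thesis
      using C by (simp add: mult.assoc mult.left_commute)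
  qed
  have "(\<integral>\<^sup>+v. ennreal (norm v ^ 4) \<partial>(gauss :: 'v measure))
      = (\<integral>\<^sup>+v. ennreal (C * exp (- (norm v)\<^sup>2 / 2)) * ennreal (norm v ^ 4) \<partial>(lborel :: 'v measure))"
    unfolding gauss_def by (subst nn_integral_density) (auto simp: dens)
  also have "\<dots> = (\<integral>\<^sup>+v. ennreal (C * exp (- (norm v)\<^sup>2 / 2) * norm v ^ 4) \<partial>(lborel :: 'v measure))"
    using C by (intro nn_integral_cong ennreal_mult[symmetric]) auto
  also have "\<dots> \<le> (\<integral>\<^sup>+v. ennreal 32 * ennreal (C * exp (- (norm ((1 / sqrt 2) *\<^sub>R v))\<^sup>2 / 2)) \<partial>(lborel :: 'v measure))"
    using le C by (intro nn_integral_mono, subst ennreal_mult[symmetric]) (auto intro!: ennreal_leI)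
  also have "\<dots> = ennreal 32 * (\<integral>\<^sup>+v. ennreal (C * exp (- (norm ((1 / sqrt 2) *\<^sub>R v))\<^sup>2 / 2)) \<partial>(lborel :: 'v measure))"
    by (rule nn_integral_cmult) measurable
  also have "\<dots> < \<infinity>"
  proof -
    have "I = ennreal (\<bar>1 / sqrt 2\<bar> ^ DIM('v)) * (\<integral>\<^sup>+v. ennreal (C * exp (- (norm ((1 / sqrt 2) *\<^sub>R v))\<^sup>2 / 2)) \<partial>(lborel :: 'v measure))"
      unfolding I_def by (rule nn_integral_lborel_scaleR) auto
    with I have "(\<integral>\<^sup>+v. ennreal (C * exp (- (norm ((1 / sqrt 2) *\<^sub>R v))\<^sup>2 / 2)) \<partial>(lborel :: 'v measure)) < \<infinity>"
      by (auto simp: ennreal_mult_eq_top_iff less_top[symmetric])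
    then show ?thesis
      by (simp add: ennreal_mult_less_top)
  qed
  finally show ?thesis
    by (intro integrableI_bounded) auto
qed

section \<open>A strong law of large numbers for uncorrelated variables\<close>

text \<open>By monotone convergence the series of the \<open>U k\<close> has finite expectation, so
  it converges almost surely and its terms tend to 0.\<close>

lemma (in prob_space) AE_tendsto_zero_of_summable_expectation:
  fixes U :: "nat \<Rightarrow> 'a \<Rightarrow> real"
  assumes int: "\<And>k. integrable M (U k)" and nonneg: "\<And>k \<omega>. 0 \<le> U k \<omega>"
    and summ: "summable (\<lambda>k. expectation (U k))"
  shows "AE \<omega> in M. (\<lambda>k. U k \<omega>) \<longlonglongrightarrow> 0"
proof -
  have [measurable]: "U k \<in> borel_measurable M" for k
    using int by auto
  have "(\<integral>\<^sup>+\<omega>. (\<Sum>k. ennreal (U k \<omega>)) \<partial>M) = (\<Sum>k. \<integral>\<^sup>+\<omega>. ennreal (U k \<omega>) \<partial>M)"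
    by (rule nn_integral_suminf) auto
  also have "\<dots> = (\<Sum>k. ennreal (expectation (U k)))"
    using int nonneg by (simp add: nn_integral_eq_integral)
  also have "\<dots> \<noteq> \<infinity>"
    using summ nonneg by (simp add: suminf_ennreal2)
  finally have "AE \<omega> in M. (\<Sum>k. ennreal (U k \<omega>)) \<noteq> \<infinity>"
    by (intro nn_integral_PInf_AE) auto
  then show ?thesis
  proof eventually_elim
    case (elim \<omega>)
    then have "summable (\<lambda>k. U k \<omega>)"
      using nonneg by (intro summable_suminf_not_top) auto
    then show ?case
      by (rule summable_LIMSEQ_zero)
  qed
qed

lemma (in prob_space) expectation_square_sum_uncorrelated:
  fixes Y :: "nat \<Rightarrow> 'a \<Rightarrow> real"
  assumes prod: "\<And>i j. integrable M (\<lambda>\<omega>. Y i \<omega> * Y j \<omega>)"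
    and uncorr: "\<And>i j. i \<noteq> j \<Longrightarrow> expectation (\<lambda>\<omega>. Y i \<omega> * Y j \<omega>) = 0"
    and bound: "\<And>i. expectation (\<lambda>\<omega>. (Y i \<omega>)\<^sup>2) \<le> C"
  shows "integrable M (\<lambda>\<omega>. (\<Sum>i<m. Y i \<omega>)\<^sup>2)" (is ?int)
    and "expectation (\<lambda>\<omega>. (\<Sum>i<m. Y i \<omega>)\<^sup>2) \<le> real m * C" (is ?le)
proof -
  have sq: "(\<Sum>i<m. Y i \<omega>)\<^sup>2 = (\<Sum>i<m. \<Sum>j<m. Y i \<omega> * Y j \<omega>)" for \<omega>
    by (simp add: power2_eq_square sum_product)
  show ?int
    unfolding sq by (intro Bochner_Integration.integrable_sum prod)
  have "expectation (\<lambda>\<omega>. (\<Sum>i<m. Y i \<omega>)\<^sup>2) = (\<Sum>i<m. \<Sum>j<m. expectation (\<lambda>\<omega>. Y i \<omega> * Y j \<omega>))"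
    unfolding sq by (simp add: prod)
  also have "\<dots> = (\<Sum>i<m. \<Sum>j<m. if i = j then expectation (\<lambda>\<omega>. (Y i \<omega>)\<^sup>2) else 0)"
    by (intro sum.cong) (auto simp: uncorr power2_eq_square)
  also have "\<dots> = (\<Sum>i<m. expectation (\<lambda>\<omega>. (Y i \<omega>)\<^sup>2))"
    by simp
  also have "\<dots> \<le> real m * C"
    using sum_mono[of "{..<m}" "\<lambda>i. expectation (\<lambda>\<omega>. (Y i \<omega>)\<^sup>2)" "\<lambda>_. C"] bound by simp
  finally show ?le .
qed

text \<open>The normalised sums converge along the squares \<open>m = k\<^sup>2\<close>, where second moments are summable;
  \<open>D k\<close> controls the fluctuation between consecutive squares.\<close>

lemma (in prob_space) strong_law_uncorrelated:
  fixes Y :: "nat \<Rightarrow> 'a \<Rightarrow> real"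
  assumes prod: "\<And>i j. integrable M (\<lambda>\<omega>. Y i \<omega> * Y j \<omega>)"
    and uncorr: "\<And>i j. i \<noteq> j \<Longrightarrow> expectation (\<lambda>\<omega>. Y i \<omega> * Y j \<omega>) = 0"
    and bound: "\<And>i. expectation (\<lambda>\<omega>. (Y i \<omega>)\<^sup>2) \<le> C"
  shows "AE \<omega> in M. (\<lambda>m. (\<Sum>i<m. Y i \<omega>) / real m) \<longlonglongrightarrow> 0"
proof -
  define S where "S m \<omega> = (\<Sum>i<m. Y i \<omega>)" for m \<omega>
  define D where "D k \<omega> = (\<Sum>i\<in>{k\<^sup>2..<(Suc k)\<^sup>2}. (Y i \<omega>)\<^sup>2)" for k \<omega>
  \<comment> \<open>Up to a factor 2, \<open>U k\<close> dominates \<open>(S m / m)\<^sup>2\<close>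
    for all \<open>m\<close> with \<open>k\<^sup>2 \<le> m < (Suc k)\<^sup>2\<close>, and its
    expectation is of order \<open>1 / k\<^sup>2\<close>. Hence almost sure convergence of
    \<open>U k\<close> to 0 gives the claim for all \<open>m\<close> at once.\<close>
  define U where "U k \<omega> = ((S (k\<^sup>2) \<omega>)\<^sup>2 + (2 * real k + 1) * D k \<omega>) / real k ^ 4" for k \<omega>
  have sq: "integrable M (\<lambda>\<omega>. (Y i \<omega>)\<^sup>2)" for i
    using prod[of i i] by (simp add: power2_eq_square)
  have C: "0 \<le> C"
    using bound[of 0] by (rule order_trans[rotated]) simp
  have S: "integrable M (\<lambda>\<omega>. (S m \<omega>)\<^sup>2)" "expectation (\<lambda>\<omega>. (S m \<omega>)\<^sup>2) \<le> real m * C" for m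
    unfolding S_def using expectation_square_sum_uncorrelated[OF prod uncorr bound] by auto
  have D: "integrable M (D k)" for k
    unfolding D_def[abs_def] by (intro Bochner_Integration.integrable_sum sq)
  have card: "real (card {k\<^sup>2..<(Suc k)\<^sup>2}) = 2 * real k + 1" for k
    by (simp add: power2_eq_square)
  have ED: "expectation (D k) \<le> (2 * real k + 1) * C" for k
  proof -
    have "expectation (D k) = (\<Sum>i\<in>{k\<^sup>2..<(Suc k)\<^sup>2}. expectation (\<lambda>\<omega>. (Y i \<omega>)\<^sup>2))"
      unfolding D_def[abs_def] by (simp add: sq)
    also have "\<dots> \<le> (\<Sum>i\<in>{k\<^sup>2..<(Suc k)\<^sup>2}. C)"
      by (intro sum_mono bound)
    finally show ?thesis
      unfolding sum_constant card .
  qed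
  have U: "integrable M (U k)" for k
    unfolding U_def[abs_def]
    by (intro Bochner_Integration.integrable_divide Bochner_Integration.integrable_add
        integrable_mult_right S D)
  have U_nonneg: "0 \<le> U k \<omega>" for k \<omega>
    unfolding U_def D_def by (simp add: sum_nonneg)
  \<comment> \<open>The constant is 10 = 1 + 9: the partial sum contributes 1, and
    \<open>2 * k + 1 \<le> 3 * k\<close> bounds the block term by 9. For \<open>k = 0\<close> both
    sides are 0, since division by 0 yields 0.\<close>
  have EU: "expectation (U k) \<le> 10 * C * inverse (real k ^ 2)" for k
  proof (cases "k = 0")
    case True
    then show ?thesis by (simp add: U_def[abs_def])
  next
    case False
    have "expectation (U k) = (expectation (\<lambda>\<omega>. (S (k\<^sup>2) \<omega>)\<^sup>2) + (2 * real k + 1) * expectation (D k)) / real k ^ 4"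
      unfolding U_def[abs_def] using S D by simp
    also have "\<dots> \<le> (real (k\<^sup>2) * C + (2 * real k + 1) * ((2 * real k + 1) * C)) / real k ^ 4"
        using S(2)[of "k\<^sup>2"] ED[of k] by (intro divide_right_mono add_mono mult_left_mono) auto
    also have "\<dots> \<le> (10 * C * (real k)\<^sup>2) / real k ^ 4"
    proof (intro divide_right_mono)
      have "(2 * real k + 1) * (2 * real k + 1) \<le> (3 * real k) * (3 * real k)"
        using False by (intro mult_mono) auto
      then have "(2 * real k + 1) * (2 * real k + 1) * C \<le> 9 * (real k)\<^sup>2 * C"
        using C by (intro mult_right_mono) (auto simp: power2_eq_square)
      then show "real (k\<^sup>2) * C + (2 * real k + 1) * ((2 * real k + 1) * C) \<le> 10 * C * (real k)\<^sup>2"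
        by (simp add: algebra_simps)
    qed simp
    also have "\<dots> = 10 * C * inverse (real k ^ 2)"
      using False by (simp add: field_simps power2_eq_square power4_eq_xxxx)
    finally show ?thesis .
  qed
  have "AE \<omega> in M. (\<lambda>k. U k \<omega>) \<longlonglongrightarrow> 0"
  proof (rule AE_tendsto_zero_of_summable_expectation[OF U U_nonneg])
    show "summable (\<lambda>k. expectation (U k))"
    proof (rule summable_comparison_test'[where g = "\<lambda>k. 10 * C * inverse (real k ^ 2)" and N = 0])
      show "summable (\<lambda>k. 10 * C * inverse (real k ^ 2))"
        by (intro summable_mult inverse_power_summable) auto
      show "norm (expectation (U k)) \<le> 10 * C * inverse (real k ^ 2)" for k
        using EU[of k] U_nonneg by simp
    qed
  qed
  then show ?thesis
  proof eventually_elim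
    case (elim \<omega>)
    have "filterlim floor_sqrt sequentially sequentially"
      unfolding filterlim_at_top_ge[of _ _ 0] 
      by (auto intro!: eventually_sequentiallyI le_floor_sqrtI)
    with elim have lim: "(\<lambda>m. sqrt (2 * U (floor_sqrt m) \<omega>)) \<longlonglongrightarrow> sqrt (2 * 0)"
      by (intro tendsto_real_sqrt tendsto_mult tendsto_const) (rule filterlim_compose)
    have "norm (S m \<omega> / real m) \<le> sqrt (2 * U (floor_sqrt m) \<omega>)" if "m \<ge> 1" for m
    proof -
      define k where "k = floor_sqrt m"
      have k: "k\<^sup>2 \<le> m" "m < (Suc k)\<^sup>2" "k \<ge> 1"
        using that floor_sqrt_power2_le[of m] Suc_floor_sqrt_power2_gt[of m]
          floor_sqrt_greater_zero_iff[of m] unfolding k_def by linarith+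
      define R where "R = (\<Sum>i\<in>{k\<^sup>2..<m}. Y i \<omega>)"
      have "S m \<omega> = S (k\<^sup>2) \<omega> + R"
        unfolding S_def R_def using k sum.atLeastLessThan_concat[of 0 "k\<^sup>2" m "\<lambda>i. Y i \<omega>"]
        by (simp add: lessThan_atLeast0)
      then have "(S m \<omega>)\<^sup>2 \<le> 2 * ((S (k\<^sup>2) \<omega>)\<^sup>2 + R\<^sup>2)"
        using sum_squares_bound[of "S (k\<^sup>2) \<omega>" R] by (simp add: power2_sum)
      \<comment> \<open>Cauchy-Schwarz over the at most \<open>2 * k + 1\<close> indices between
        \<open>k\<^sup>2\<close> and \<open>m\<close>.\<close>
      also have "R\<^sup>2 \<le> (2 * real k + 1) * D k \<omega>"
      proof -
        have "R\<^sup>2 \<le> (\<Sum>i\<in>{k\<^sup>2..<m}. (Y i \<omega>)\<^sup>2) * card {k\<^sup>2..<m}"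
          unfolding R_def by (rule sum_squared_le_sum_of_squares)
        also have "\<dots> \<le> D k \<omega> * card {k\<^sup>2..<(Suc k)\<^sup>2}"
          unfolding D_def using k
          by (intro mult_mono sum_mono2 of_nat_mono card_mono) (auto intro: sum_nonneg)
        finally show ?thesis
          unfolding card by (simp add: mult.commute)
      qed
      finally have "(S m \<omega>)\<^sup>2 \<le> 2 * U k \<omega> * (real k ^ 2)\<^sup>2"
        using k(3) by (simp add: U_def power2_eq_square power4_eq_xxxx)
      also have "\<dots> \<le> 2 * U k \<omega> * (real m)\<^sup>2"
        using k(1) U_nonneg[of k \<omega>] by (intro mult_left_mono power_mono) (auto simp flip: of_nat_power)
      finally have "(S m \<omega> / real m)\<^sup>2 \<le> 2 * U k \<omega>"
        using that by (simp add: power_divide divide_le_eq)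
      then have "\<bar>S m \<omega> / real m\<bar> \<le> sqrt (2 * U k \<omega>)"
        by (intro real_le_rsqrt) (simp only: power2_abs)
      then show ?thesis
        by (simp add: k_def)
    qed
    then have bnd: "eventually (\<lambda>m. norm (S m \<omega> / real m) \<le> sqrt (2 * U (floor_sqrt m) \<omega>)) sequentially"
      by (rule eventually_sequentiallyI)
    show ?case
      using Lim_null_comparison[OF bnd] lim unfolding S_def by simp
  qed
qed

section \<open>Weighted means and deterministic bounds on them\<close>

text \<open>Common form of the hard and soft estimators, with \<open>w\<close> the indicator of a
  cell or a softmax weight. If the total weight is 0, the value is 0.\<close>

definition weighted_mean :: "('v::real_vector \<Rightarrow> real) \<Rightarrow> (nat \<Rightarrow> 'v) \<Rightarrow> nat \<Rightarrow> 'v" where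
  "weighted_mean w ns m = (1 / (\<Sum>i<m. w (ns i))) *\<^sub>R (\<Sum>i<m. w (ns i) *\<^sub>R ns i)"

lemma weighted_mean_inner:
  fixes a :: "'v::real_inner"
  shows "weighted_mean w ns m \<bullet> a = (\<Sum>i<m. w (ns i) * (ns i \<bullet> a)) / (\<Sum>i<m. w (ns i))"
  by (simp add: weighted_mean_def inner_sum_left)

lemma abs_le_truncation_plus_power4:
  fixes f K :: real
  assumes "K > 0"
  shows "\<bar>f\<bar> \<le> K + f ^ 4 / K ^ 3"
proof (cases "\<bar>f\<bar> \<le> K")
  case True
  moreover have "0 \<le> f ^ 4 / K ^ 3"
    using assms by simp
  ultimately show ?thesis by linarith
next
  case False
  then have "\<bar>f\<bar> * K ^ 3 \<le> \<bar>f\<bar> * \<bar>f\<bar> ^ 3"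
    using assms by (intro mult_left_mono power_mono) auto
  also have "\<dots> = f ^ 4"
    by (simp add: power4_eq_xxxx power3_eq_cube abs_mult[symmetric])
  finally have "\<bar>f\<bar> \<le> f ^ 4 / K ^ 3"
    using assms by (simp add: le_divide_eq)
  then show ?thesis
    using assms by linarith
qed

text \<open>The bound does not involve the weights, so it survives when the total weight is
  arbitrarily small. Values up to \<open>K\<close> average to at most \<open>K\<close>; in the
  truncation error every single weight is at most the total weight, which therefore cancels.\<close>

lemma weighted_average_le:
  fixes w f :: "nat \<Rightarrow> real"
  assumes w: "\<And>i. 0 \<le> w i" and K: "K > 0"
  shows "\<bar>(\<Sum>i<m. w i * f i) / (\<Sum>i<m. w i)\<bar> \<le> K + (\<Sum>i<m. f i ^ 4) / K ^ 3"
proof -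
  define W where "W = (\<Sum>i<m. w i)"
  have W: "W \<ge> 0"
    unfolding W_def using w by (simp add: sum_nonneg)
  have le_W: "w i \<le> W" if "i < m" for i
    unfolding W_def using w that by (intro member_le_sum) auto
  have "\<bar>\<Sum>i<m. w i * f i\<bar> \<le> (\<Sum>i<m. w i * \<bar>f i\<bar>)"
    using w by (intro order_trans[OF sum_abs]) (simp add: abs_mult)
  also have "\<dots> \<le> (\<Sum>i<m. w i * (K + f i ^ 4 / K ^ 3))"
    using w abs_le_truncation_plus_power4[OF K] by (intro sum_mono mult_left_mono) auto
  also have "\<dots> = W * K + (\<Sum>i<m. w i * (f i ^ 4 / K ^ 3))"
    by (simp add: W_def sum.distrib sum_distrib_right distrib_left)
  also have "\<dots> \<le> W * K + (\<Sum>i<m. W * (f i ^ 4 / K ^ 3))"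
    using K le_W by (intro add_left_mono sum_mono mult_right_mono) auto
  also have "\<dots> = W * (K + (\<Sum>i<m. f i ^ 4) / K ^ 3)"
    by (simp add: sum_distrib_left sum_divide_distrib distrib_left)
  finally have *: "\<bar>\<Sum>i<m. w i * f i\<bar> \<le> W * (K + (\<Sum>i<m. f i ^ 4) / K ^ 3)" .
  \<comment> \<open>Covers total weight 0, where the quotient is 0 by convention.\<close>
  have "0 \<le> K + (\<Sum>i<m. f i ^ 4) / K ^ 3"
    using K by (intro add_nonneg_nonneg divide_nonneg_nonneg sum_nonneg) auto
  moreover have "\<bar>\<Sum>i<m. w i * f i\<bar> / W \<le> K + (\<Sum>i<m. f i ^ 4) / K ^ 3" if "W > 0"
    using * that by (simp add: pos_divide_le_eq mult.commute)
  ultimately show ?thesis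
    unfolding W_def[symmetric] using W by (cases "W = 0") simp_all
qed

text \<open>The first summand controls the ratio when the empirical weight is at least \<open>p / 2\<close>; on the
  complementary rare event the ratio is only bounded by the truncation estimate, and the factor
  \<open>4 / p\<^sup>2 * (W / m - p)\<^sup>2\<close> dominates the indicator of that event.\<close>

lemma weighted_average_deviation:
  fixes w f :: "nat \<Rightarrow> real"
  assumes w: "\<And>i. 0 \<le> w i" and K: "K > 0" and p: "p > 0" and m: "m > 0"
  defines "W \<equiv> \<Sum>i<m. w i"
  shows "\<bar>(\<Sum>i<m. w i * f i) / W - c\<bar>
    \<le> 2 / p * (1 / K + K * ((\<Sum>i<m. w i * (f i - c)) / m)\<^sup>2)
      + (K + \<bar>c\<bar>) * (4 / p\<^sup>2 * (W / m - p)\<^sup>2) + (\<Sum>i<m. f i ^ 4) / K ^ 3"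
    (is "?l \<le> ?A + ?B + ?C")
proof -
  define Y where "Y = (\<Sum>i<m. w i * (f i - c))"
  have A: "?A \<ge> 0" and B: "?B \<ge> 0" and C: "?C \<ge> 0"
    using K p by (simp_all add: sum_nonneg)
  show ?thesis
  proof (cases "W / m \<ge> p / 2")
    case True
    then have W: "W \<ge> m * p / 2"
      using m by (simp add: field_simps)
    moreover have "m * p / 2 > 0"
      using m p by simp
    ultimately have W0: "W > 0"
      by linarith
    have "(\<Sum>i<m. w i * f i) - c * W = Y"
      by (simp add: Y_def W_def sum_distrib_left sum_subtractf algebra_simps)
    then have "(\<Sum>i<m. w i * f i) / W - c = Y / W"
      using W0 by (simp add: field_simps)
    then have "?l = \<bar>Y\<bar> / W"
      using W0 by simp
    also have "\<dots> \<le> \<bar>Y\<bar> / (m * p / 2)"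
      using W W0 m p by (intro divide_left_mono) auto
    also have "\<dots> = 2 / p * \<bar>Y / m\<bar>"
      by (simp add: mult.commute)
    also have "\<dots> \<le> ?A"
    proof (intro mult_left_mono)
      define y where "y = Y / m"
      \<comment> \<open>Trading the absolute value for a square makes the bound computable from
        second moments. If \<open>\<bar>y\<bar>\<close> exceeds \<open>1 / K\<close>, then
        \<open>K * \<bar>y\<bar>\<close> is at least 1 and can be multiplied in.\<close>
      have "\<bar>y\<bar> \<le> 1 / K + K * y\<^sup>2"
      proof (cases "\<bar>y\<bar> \<le> 1 / K")
        case True
        moreover have "0 \<le> K * y\<^sup>2"
          using K by simp
        ultimately show ?thesis by linarith
      next
        case False
        then have "1 * \<bar>y\<bar> \<le> (K * \<bar>y\<bar>) * \<bar>y\<bar>"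
          using K by (intro mult_right_mono) (auto simp: field_simps)
        also have "\<dots> = K * y\<^sup>2"
          by (simp add: power2_eq_square)
        finally have "\<bar>y\<bar> \<le> K * y\<^sup>2" by simp
        moreover have "0 < 1 / K"
          using K by simp
        ultimately show ?thesis by linarith
      qed
      then show "\<bar>Y / m\<bar> \<le> 1 / K + K * ((\<Sum>i<m. w i * (f i - c)) / m)\<^sup>2"
        by (simp add: y_def Y_def)
    qed (use p in simp)
    finally show ?thesis
      using B C by linarith
  next
    case False
    then have "(p / 2)\<^sup>2 \<le> (p - W / m)\<^sup>2"
      using p by (intro power_mono) auto
    then have ge1: "1 \<le> 4 / p\<^sup>2 * (W / m - p)\<^sup>2"
      using p by (simp add: field_simps power2_commute)
    have "?l \<le> \<bar>(\<Sum>i<m. w i * f i) / W\<bar> + \<bar>c\<bar>"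
      by (rule abs_triangle_ineq4)
    also have "\<dots> \<le> (K + \<bar>c\<bar>) * 1 + ?C"
      unfolding W_def using weighted_average_le[OF w K, where m = m and f = f] by simp
    also have "\<dots> \<le> ?B + ?C"
      using ge1 K by (intro add_right_mono mult_left_mono) auto
    finally show ?thesis
      using A by linarith
  qed
qed

section \<open>Limits of weighted means of an i.i.d. sequence\<close>

locale iid_sequence = prob_space M
  for M :: "'a measure" +
  fixes X :: "nat \<Rightarrow> 'a \<Rightarrow> 'v::euclidean_space" and N :: "'v measure"
  assumes indep: "indep_vars (\<lambda>_. borel) X UNIV"
    and distr_X: "\<And>i. distr M borel (X i) = N"
begin

lemma X_measurable [measurable]: "X i \<in> borel_measurable M"
  using indep by (auto simp: indep_vars_def)

lemma sets_N [measurable_cong]: "sets N = sets borel"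
  using distr_X[of 0] by auto

lemma prob_space_N: "prob_space N"
  using prob_space_distr[OF X_measurable[of 0]] by (simp add: distr_X)

lemma integrable_X:
  fixes g :: "'v \<Rightarrow> real"
  assumes "g \<in> borel_measurable borel" "integrable N g"
  shows "integrable M (\<lambda>\<omega>. g (X i \<omega>))"
  using assms(2) unfolding distr_X[of i, symmetric]
  by (subst (asm) integrable_distr_eq) (use assms(1) in auto)

lemma expectation_X:
  fixes g :: "'v \<Rightarrow> real"
  assumes "g \<in> borel_measurable borel"
  shows "expectation (\<lambda>\<omega>. g (X i \<omega>)) = integral\<^sup>L N g"
  unfolding distr_X[of i, symmetric] by (rule integral_distr[symmetric]) (use assms in auto)

lemma integrable_of_square:
  fixes g :: "'v \<Rightarrow> real"
  assumes [measurable]: "g \<in> borel_measurable borel" and sq: "integrable N (\<lambda>v. (g v)\<^sup>2)"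
  shows "integrable N g"
proof (rule Bochner_Integration.integrable_bound)
  interpret N: prob_space N by (rule prob_space_N)
  show "integrable N (\<lambda>v. 1 + (g v)\<^sup>2)"
    using sq by simp
  have "\<bar>y\<bar> \<le> \<bar>1 + y\<^sup>2\<bar>" for y :: real
  proof -
    have "0 \<le> (\<bar>y\<bar> - 1)\<^sup>2" by simp
    then have "2 * \<bar>y\<bar> \<le> 1 + y\<^sup>2" by (simp add: power2_diff)
    then show ?thesis by linarith
  qed
  then show "AE v in N. norm (g v) \<le> norm (1 + (g v)\<^sup>2)"
    by simp
qed measurable

context
  fixes g :: "'v \<Rightarrow> real"
  assumes g [measurable]: "g \<in> borel_measurable borel"
    and g_sq: "integrable N (\<lambda>v. (g v)\<^sup>2)" and g_mean: "integral\<^sup>L N g = 0"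
begin

lemma centered_square_expectation: "expectation (\<lambda>\<omega>. (g (X i \<omega>))\<^sup>2) \<le> integral\<^sup>L N (\<lambda>v. (g v)\<^sup>2)"
  using expectation_X[of "\<lambda>v. (g v)\<^sup>2" i] by simp

lemma indep_g: "indep_vars (\<lambda>_. borel) (\<lambda>i \<omega>. g (X i \<omega>)) {i, j}"
  using indep_vars_compose2[OF indep_vars_subset[OF indep, of "{i, j}"], of "\<lambda>_. g"] by simp

lemma g_integrable: "integrable M (\<lambda>\<omega>. g (X i \<omega>))"
  by (rule integrable_X[OF g integrable_of_square[OF g g_sq]])

lemma centered_product_integrable: "integrable M (\<lambda>\<omega>. g (X i \<omega>) * g (X j \<omega>))"
proof (cases "i = j")
  case True
  then show ?thesis
    using integrable_X[OF _ g_sq, of i] by (simp add: power2_eq_square)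
next
  case False
  then show ?thesis
    using indep_vars_integrable[OF _ indep_g g_integrable, of i j] by simp
qed

lemma centered_uncorrelated:
  assumes "i \<noteq> j"
  shows "expectation (\<lambda>\<omega>. g (X i \<omega>) * g (X j \<omega>)) = 0"
  using assms indep_vars_lebesgue_integral[OF _ indep_g g_integrable, of i j]
  by (simp add: expectation_X[OF g] g_mean)

lemmas centered_sum_square =
  expectation_square_sum_uncorrelated[where Y = "\<lambda>i \<omega>. g (X i \<omega>)",
    OF centered_product_integrable centered_uncorrelated centered_square_expectation]

lemmas centered_strong_law =
  strong_law_uncorrelated[where Y = "\<lambda>i \<omega>. g (X i \<omega>)",
    OF centered_product_integrable centered_uncorrelated centered_square_expectation]

end

text \<open>After subtracting the mean, independence makes the summands uncorrelated, so
  \<open>strong_law_uncorrelated\<close> applies.\<close>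

lemma strong_law:
  fixes g :: "'v \<Rightarrow> real"
  assumes [measurable]: "g \<in> borel_measurable borel" and sq: "integrable N (\<lambda>v. (g v)\<^sup>2)"
  shows "AE \<omega> in M. (\<lambda>m. (\<Sum>i<m. g (X i \<omega>)) / real m) \<longlonglongrightarrow> integral\<^sup>L N g"
proof -
  interpret N: prob_space N by (rule prob_space_N)
  have g: "integrable N g"
    by (rule integrable_of_square[OF assms])
  define \<mu> where "\<mu> = integral\<^sup>L N g"
  have "AE \<omega> in M. (\<lambda>m. (\<Sum>i<m. g (X i \<omega>) - \<mu>) / real m) \<longlonglongrightarrow> 0"
  proof (rule centered_strong_law[where g = "\<lambda>v. g v - \<mu>"])
    show "integrable N (\<lambda>v. (g v - \<mu>)\<^sup>2)"
      using g sq by (simp add: power2_diff)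
    show "integral\<^sup>L N (\<lambda>v. g v - \<mu>) = 0"
      using g by (simp add: \<mu>_def N.prob_space)
  qed measurable
  then show ?thesis
  proof eventually_elim
    case (elim \<omega>)
    have ev: "eventually (\<lambda>m. (\<Sum>i<m. g (X i \<omega>) - \<mu>) / real m + \<mu> = (\<Sum>i<m. g (X i \<omega>)) / real m) sequentially"
      by (rule eventually_sequentiallyI[of 1]) (simp add: sum_subtractf diff_divide_distrib)
    have lim: "(\<lambda>m. (\<Sum>i<m. g (X i \<omega>) - \<mu>) / real m + \<mu>) \<longlonglongrightarrow> 0 + \<mu>"
      by (intro tendsto_add elim tendsto_const)
    show ?case
      using Lim_transform_eventually[OF lim ev] by (simp add: \<mu>_def)
  qed
qed

lemma tendsto_mean_inverse_sqrt:
  fixes R :: "nat \<Rightarrow> 'a \<Rightarrow> real"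
  assumes int: "\<And>m. integrable M (R m)"
    and dev: "\<And>m. m \<ge> 1 \<Longrightarrow> expectation (\<lambda>\<omega>. \<bar>R m \<omega> - c\<bar>) \<le> A / sqrt (real m)"
  shows "(\<lambda>m. expectation (R m)) \<longlonglongrightarrow> c"
proof -
  have "(\<lambda>m. A / sqrt (real m)) \<longlonglongrightarrow> 0"
    by (intro tendsto_divide_0[OF tendsto_const] filterlim_at_top_imp_at_infinity
        filterlim_compose[OF sqrt_at_top filterlim_real_sequentially])
  moreover have "eventually (\<lambda>m. norm (expectation (R m) - c) \<le> A / sqrt (real m)) sequentially"
  proof (rule eventually_sequentiallyI)
    fix m :: nat assume m: "1 \<le> m"
    have "expectation (R m) - c = expectation (\<lambda>\<omega>. R m \<omega> - c)"
      using int[of m] by (simp add: prob_space)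
    also have "norm \<dots> \<le> expectation (\<lambda>\<omega>. \<bar>R m \<omega> - c\<bar>)"
      using integral_norm_bound[of M "\<lambda>\<omega>. R m \<omega> - c"] by simp
    also have "\<dots> \<le> A / sqrt (real m)"
      by (rule dev[OF m])
    finally show "norm (expectation (R m) - c) \<le> A / sqrt (real m)" .
  qed
  ultimately have "(\<lambda>m. expectation (R m) - c) \<longlonglongrightarrow> 0"
    by (rule Lim_null_comparison[rotated])
  then show ?thesis
    by (rule LIM_zero_cancel)
qed

context
  fixes w :: "'v \<Rightarrow> real"
  assumes w_measurable [measurable]: "w \<in> borel_measurable borel"
    and w_nonneg: "\<And>v. 0 \<le> w v" and w_le_1: "\<And>v. w v \<le> 1"
    and moment: "integrable N (\<lambda>v. norm v ^ 4)"
    and w_pos: "0 < integral\<^sup>L N w"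
begin

lemma inner_power4_integrable: "integrable N (\<lambda>v. (v \<bullet> a) ^ 4)"
proof (rule Bochner_Integration.integrable_bound)
  show "integrable N (\<lambda>v. norm a ^ 4 * norm v ^ 4)"
    using moment by simp
  have "\<bar>v \<bullet> a\<bar> ^ 4 \<le> (norm v * norm a) ^ 4" for v
    by (intro power_mono Cauchy_Schwarz_ineq2) auto
  then show "AE v in N. norm ((v \<bullet> a) ^ 4) \<le> norm (norm a ^ 4 * norm v ^ 4)"
    by (simp add: power_abs power_mult_distrib mult.commute)
qed measurable

lemma weighted_affine_square_integrable: "integrable N (\<lambda>v. (w v * (v \<bullet> a - c))\<^sup>2)"
proof (rule Bochner_Integration.integrable_bound)
  interpret N: prob_space N by (rule prob_space_N)
  show "integrable N (\<lambda>v. 1 + 2 * c\<^sup>2 + (v \<bullet> a) ^ 4)"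
    using inner_power4_integrable by simp
  have "(w v * (v \<bullet> a - c))\<^sup>2 \<le> 1 + 2 * c\<^sup>2 + (v \<bullet> a) ^ 4" for v
  proof -
    have "(w v)\<^sup>2 * (v \<bullet> a - c)\<^sup>2 \<le> 1 * (v \<bullet> a - c)\<^sup>2"
      using w_nonneg[of v] w_le_1[of v] by (intro mult_right_mono power_le_one) auto
    also have "\<dots> \<le> 2 * (v \<bullet> a)\<^sup>2 + 2 * c\<^sup>2"
      using zero_le_power2[of "v \<bullet> a + c"] by (simp add: power2_diff power2_sum)
    also have "2 * (v \<bullet> a)\<^sup>2 \<le> 1 + (v \<bullet> a) ^ 4"
      using zero_le_power2[of "(v \<bullet> a)\<^sup>2 - 1"] by (simp add: power2_diff flip: power_mult)
    finally show ?thesis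
      by (simp add: power_mult_distrib)
  qed
  then show "AE v in N. norm ((w v * (v \<bullet> a - c))\<^sup>2) \<le> norm (1 + 2 * c\<^sup>2 + (v \<bullet> a) ^ 4)"
    by (intro AE_I2) (smt (verit) real_norm_def zero_le_power2)
qed measurable

lemma weight_square_integrable: "integrable N (\<lambda>v. (w v - p)\<^sup>2)"
proof -
  interpret N: prob_space N by (rule prob_space_N)
  have "\<bar>w v\<bar> \<le> 1" for v
    using w_nonneg[of v] w_le_1[of v] by simp
  then have "\<bar>w v - p\<bar> \<le> 1 + \<bar>p\<bar>" for v
    by (rule order_trans[OF abs_triangle_ineq4 add_right_mono])
  then have "(w v - p)\<^sup>2 \<le> (1 + \<bar>p\<bar>)\<^sup>2" for v
    by (metis abs_ge_zero power2_abs power_mono)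
  then show ?thesis
    by (intro N.integrable_const_bound[where B = "(1 + \<bar>p\<bar>)\<^sup>2"]) auto
qed

lemma weight_integrable: "integrable N w"
  using integrable_of_square[OF w_measurable] weight_square_integrable[of 0] by simp

lemma weighted_inner_integrable: "integrable N (\<lambda>v. w v * (v \<bullet> a))"
  using integrable_of_square[of "\<lambda>v. w v * (v \<bullet> a)"] weighted_affine_square_integrable[of a 0] by simp

text \<open>The strong law applies separately to numerator and denominator, both divided by
  \<open>m\<close>; the limit of the denominator is nonzero by \<open>w_pos\<close>.\<close>

lemma weighted_mean_tendsto_AE:
  "AE \<omega> in M. \<forall>a\<in>Basis. (\<lambda>m. weighted_mean w (\<lambda>i. X i \<omega>) m \<bullet> a)
     \<longlonglongrightarrow> (\<integral>v. w v * (v \<bullet> a) \<partial>N) / integral\<^sup>L N w"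
proof (rule AE_finite_allI[OF finite_Basis])
  fix a :: 'v
  have "AE \<omega> in M. (\<lambda>m. (\<Sum>i<m. w (X i \<omega>) * (X i \<omega> \<bullet> a)) / real m) \<longlonglongrightarrow> (\<integral>v. w v * (v \<bullet> a) \<partial>N)"
    using strong_law[of "\<lambda>v. w v * (v \<bullet> a)"] weighted_affine_square_integrable[of a 0] by simp
  moreover have "AE \<omega> in M. (\<lambda>m. (\<Sum>i<m. w (X i \<omega>)) / real m) \<longlonglongrightarrow> integral\<^sup>L N w"
    using strong_law[OF w_measurable] weight_square_integrable[of 0] by simp
  ultimately show "AE \<omega> in M. (\<lambda>m. weighted_mean w (\<lambda>i. X i \<omega>) m \<bullet> a)
     \<longlonglongrightarrow> (\<integral>v. w v * (v \<bullet> a) \<partial>N) / integral\<^sup>L N w"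
  proof eventually_elim
    case (elim \<omega>)
    have lim: "(\<lambda>m. ((\<Sum>i<m. w (X i \<omega>) * (X i \<omega> \<bullet> a)) / real m) / ((\<Sum>i<m. w (X i \<omega>)) / real m))
      \<longlonglongrightarrow> (\<integral>v. w v * (v \<bullet> a) \<partial>N) / integral\<^sup>L N w"
      using w_pos by (intro tendsto_divide elim) simp
    have ev: "eventually (\<lambda>m. ((\<Sum>i<m. w (X i \<omega>) * (X i \<omega> \<bullet> a)) / real m) / ((\<Sum>i<m. w (X i \<omega>)) / real m)
      = weighted_mean w (\<lambda>i. X i \<omega>) m \<bullet> a) sequentially"
      by (rule eventually_sequentiallyI[of 1]) (simp add: weighted_mean_inner)
    show ?case
      by (rule Lim_transform_eventually[OF lim ev])
  qed
qed

lemma weighted_mean_inner_integrable: "integrable M (\<lambda>\<omega>. weighted_mean w (\<lambda>i. X i \<omega>) m \<bullet> a)"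
proof (rule Bochner_Integration.integrable_bound)
  show "integrable M (\<lambda>\<omega>. 1 + (\<Sum>i<m. (X i \<omega> \<bullet> a) ^ 4))"
    using integrable_X[OF _ inner_power4_integrable[of a]]
    by (intro Bochner_Integration.integrable_add Bochner_Integration.integrable_sum) auto
  show "(\<lambda>\<omega>. weighted_mean w (\<lambda>i. X i \<omega>) m \<bullet> a) \<in> borel_measurable M"
    unfolding weighted_mean_inner by measurable
  have "\<bar>weighted_mean w (\<lambda>i. X i \<omega>) m \<bullet> a\<bar> \<le> 1 + (\<Sum>i<m. (X i \<omega> \<bullet> a) ^ 4)" for \<omega>
    unfolding weighted_mean_inner
    using weighted_average_le[where K = 1 and w = "\<lambda>i. w (X i \<omega>)" and f = "\<lambda>i. X i \<omega> \<bullet> a" and m = m]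
    by (simp add: w_nonneg)
  then show "AE \<omega> in M. norm (weighted_mean w (\<lambda>i. X i \<omega>) m \<bullet> a) \<le> norm (1 + (\<Sum>i<m. (X i \<omega> \<bullet> a) ^ 4))"
    by (intro AE_I2) (metis abs_ge_self order_trans real_norm_def)
qed

text \<open>Almost sure convergence alone does not give convergence of expectations, because the
  denominator can be small. Instead \<open>weighted_average_deviation\<close> is integrated with a
  truncation level depending on \<open>m\<close>.\<close>

lemma expectation_weighted_mean_tendsto:
  "(\<lambda>m. expectation (\<lambda>\<omega>. weighted_mean w (\<lambda>i. X i \<omega>) m \<bullet> a))
     \<longlonglongrightarrow> (\<integral>v. w v * (v \<bullet> a) \<partial>N) / integral\<^sup>L N w"
proof -
  interpret N: prob_space N by (rule prob_space_N)
  define p where "p = integral\<^sup>L N w"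
  define c where "c = (\<integral>v. w v * (v \<bullet> a) \<partial>N) / p"
  define C1 where "C1 = (\<integral>v. (w v * (v \<bullet> a - c))\<^sup>2 \<partial>N)"
  define C2 where "C2 = (\<integral>v. (w v - p)\<^sup>2 \<partial>N)"
  define C3 where "C3 = (\<integral>v. (v \<bullet> a) ^ 4 \<partial>N)"
  define Y where "Y m \<omega> = (\<Sum>i<m. w (X i \<omega>) * (X i \<omega> \<bullet> a - c))" for m \<omega>
  define V where "V m \<omega> = (\<Sum>i<m. w (X i \<omega>) - p)" for m \<omega>
  define F where "F m \<omega> = (\<Sum>i<m. (X i \<omega> \<bullet> a) ^ 4)" for m \<omega>
  have p: "p > 0"
    using w_pos by (simp add: p_def)
  have Y: "integrable M (\<lambda>\<omega>. (Y m \<omega>)\<^sup>2)" "expectation (\<lambda>\<omega>. (Y m \<omega>)\<^sup>2) \<le> real m * C1" for m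
  proof -
    \<comment> \<open>The limit \<open>c\<close> is exactly the constant that centres the weighted
      summands, so the second moment of \<open>Y m\<close> grows only linearly in
      \<open>m\<close>.\<close>
    have "(\<integral>v. w v * (v \<bullet> a - c) \<partial>N) = 0"
      using p weighted_inner_integrable[of a] weight_integrable
      by (simp add: right_diff_distrib c_def p_def[symmetric])
    then show "integrable M (\<lambda>\<omega>. (Y m \<omega>)\<^sup>2)" "expectation (\<lambda>\<omega>. (Y m \<omega>)\<^sup>2) \<le> real m * C1"
      unfolding Y_def C1_def
      using centered_sum_square[of "\<lambda>v. w v * (v \<bullet> a - c)", OF _ weighted_affine_square_integrable]
      by simp_all
  qed
  have V: "integrable M (\<lambda>\<omega>. (V m \<omega>)\<^sup>2)" "expectation (\<lambda>\<omega>. (V m \<omega>)\<^sup>2) \<le> real m * C2" for m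
  proof -
    have "(\<integral>v. w v - p \<partial>N) = 0"
      using weight_integrable by (simp add: p_def N.prob_space)
    then show "integrable M (\<lambda>\<omega>. (V m \<omega>)\<^sup>2)" "expectation (\<lambda>\<omega>. (V m \<omega>)\<^sup>2) \<le> real m * C2"
      unfolding V_def C2_def
      using centered_sum_square[of "\<lambda>v. w v - p", OF _ weight_square_integrable]
      by simp_all
  qed
  have F: "integrable M (F m)" "expectation (F m) = real m * C3" for m
  proof -
    have i: "integrable M (\<lambda>\<omega>. (X i \<omega> \<bullet> a) ^ 4)" for i
      using integrable_X[OF _ inner_power4_integrable[of a]] by simp
    then show "integrable M (F m)"
      unfolding F_def[abs_def] by (intro Bochner_Integration.integrable_sum)
    show "expectation (F m) = real m * C3"
      unfolding F_def[abs_def] using i expectation_X[of "\<lambda>v. (v \<bullet> a) ^ 4"] by (simp add: C3_def)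
  qed
  have C2: "C2 \<ge> 0"
    by (simp add: C2_def)
  let ?R = "\<lambda>m \<omega>. weighted_mean w (\<lambda>i. X i \<omega>) m \<bullet> a"
  have dev: "expectation (\<lambda>\<omega>. \<bar>?R m \<omega> - c\<bar>)
      \<le> (2 / p * (1 + C1) + (1 + \<bar>c\<bar>) * (4 / p\<^sup>2 * C2) + C3) / sqrt (real m)" if m: "m \<ge> 1" for m
  proof -
    \<comment> \<open>The choice \<open>sqrt m\<close> balances the error terms:
      \<open>1 / K\<close>, \<open>K / m\<close> and \<open>m / K ^ 3\<close> are all equal to
      \<open>1 / sqrt m\<close>.\<close>
    define K where "K = sqrt (real m)"
    have K: "K \<ge> 1" "K\<^sup>2 = m"
      using m by (simp_all add: K_def)
    let ?B = "\<lambda>\<omega>. 2 / p * (1 / K + K * (Y m \<omega> / m)\<^sup>2)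
      + (K + \<bar>c\<bar>) * (4 / p\<^sup>2 * (V m \<omega> / m)\<^sup>2) + F m \<omega> / K ^ 3"
    have "(\<Sum>i<m. w (X i \<omega>)) / m - p = V m \<omega> / m" for \<omega>
      using m by (simp add: V_def sum_subtractf field_simps)
    then have le: "\<bar>?R m \<omega> - c\<bar> \<le> ?B \<omega>" for \<omega>
      using weighted_average_deviation[where K = K and w = "\<lambda>i. w (X i \<omega>)" and f = "\<lambda>i. X i \<omega> \<bullet> a"
          and m = m and p = p and c = c] K(1) p m
      by (simp add: w_nonneg weighted_mean_inner Y_def F_def)
    have intB: "integrable M ?B"
      using Y(1)[of m] V(1)[of m] F(1)[of m] by (simp add: power_divide)
    have "expectation (\<lambda>\<omega>. \<bar>?R m \<omega> - c\<bar>) \<le> expectation ?B"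
      using le by (intro integral_mono intB integrable_abs Bochner_Integration.integrable_diff
          weighted_mean_inner_integrable) auto
    also have "expectation ?B = 2 / p * (1 / K + K * (expectation (\<lambda>\<omega>. (Y m \<omega>)\<^sup>2) / (real m)\<^sup>2))
      + (K + \<bar>c\<bar>) * (4 / p\<^sup>2 * (expectation (\<lambda>\<omega>. (V m \<omega>)\<^sup>2) / (real m)\<^sup>2)) + expectation (F m) / K ^ 3"
      using Y(1)[of m] V(1)[of m] F(1)[of m] by (simp add: power_divide prob_space)
    also have "\<dots> \<le> 2 / p * (1 / K + K * (real m * C1 / (real m)\<^sup>2))
      + (K + \<bar>c\<bar>) * (4 / p\<^sup>2 * (real m * C2 / (real m)\<^sup>2)) + real m * C3 / K ^ 3"
      using Y(2)[of m] V(2)[of m] F(2)[of m] K(1) p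
      by (intro add_mono mult_left_mono divide_right_mono) auto
    also have "\<dots> = 2 / p * ((1 + C1) / K) + (K + \<bar>c\<bar>) * (4 / p\<^sup>2 * (C2 / K\<^sup>2)) + C3 / K"
      unfolding K(2)[symmetric] using K(1)
      by (simp add: power2_eq_square power3_eq_cube add_divide_distrib)
    also have "(K + \<bar>c\<bar>) * (4 / p\<^sup>2 * (C2 / K\<^sup>2)) \<le> (K * (1 + \<bar>c\<bar>)) * (4 / p\<^sup>2 * (C2 / K\<^sup>2))"
      using K(1) C2 mult_right_mono[of 1 K "\<bar>c\<bar>"] by (intro mult_right_mono) (auto simp: distrib_left)
    also have "\<dots> = (1 + \<bar>c\<bar>) * (4 / p\<^sup>2 * C2) / K"
      using K(1) by (simp add: power2_eq_square)
    finally show ?thesis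
      unfolding K_def[symmetric] by (simp add: add_divide_distrib mult.commute)
  qed
  show ?thesis
    using tendsto_mean_inverse_sqrt[OF weighted_mean_inner_integrable dev]
    unfolding c_def p_def .
qed

end

end

section \<open>Reflections and positive correlation under the Gaussian measure\<close>

text \<open>The Gaussian density is positive everywhere, so a vanishing integral would force
  \<open>g\<close> to vanish Lebesgue-almost everywhere, hence \<open>U\<close> to be an open null
  set and therefore empty.\<close>

lemma integral_gauss_pos:
  fixes g :: "'v::euclidean_space \<Rightarrow> real"
  assumes int: "integrable gauss g" and nonneg: "\<And>v. 0 \<le> g v"
    and U: "open U" "U \<noteq> {}" and pos: "\<And>v. v \<in> U \<Longrightarrow> 0 < g v"
  shows "0 < integral\<^sup>L gauss g"
proof (rule ccontr)
  assume "\<not> 0 < integral\<^sup>L gauss g"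
  then have "integral\<^sup>L gauss g = 0"
    using nonneg by (simp add: antisym)
  then have "AE v in gauss. g v = 0"
    using integral_nonneg_eq_0_iff_AE[OF int] nonneg by simp
  then have "AE v in lborel. 0 < (std_gauss_density v :: ennreal) \<longrightarrow> g v = 0"
    unfolding gauss_def by (subst (asm) AE_density) auto
  then have "AE v in lborel. v \<notin> U"
    by eventually_elim (use pos in \<open>force simp: std_gauss_density_def\<close>)
  then show False
    using open_AE_lborel_nonempty[OF U(1)] U(2) by blast
qed

text \<open>The Householder reflection in the hyperplane orthogonal to \<open>a\<close>; for
  \<open>a = 0\<close> it is the identity, as \<open>2 / 0 = 0\<close>.\<close>

definition reflect :: "'v::real_inner \<Rightarrow> 'v \<Rightarrow> 'v" where
  "reflect a v = v - (2 / (a \<bullet> a) * (v \<bullet> a)) *\<^sub>R a"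

lemma orthogonal_transformation_reflect: "orthogonal_transformation (reflect a)"
proof -
  have "linear (reflect a)"
    by (rule linearI) (simp_all add: reflect_def inner_add_left algebra_simps add_divide_distrib)
  moreover have "reflect a u \<bullet> reflect a v = u \<bullet> v" for u v
  proof (cases "a = 0")
    case False
    define k where "k = 2 / (a \<bullet> a)"
    have k: "k * (a \<bullet> a) = 2"
      using False by (simp add: k_def)
    have "(k * (u \<bullet> a)) * (k * (v \<bullet> a)) * (a \<bullet> a) = (k * (a \<bullet> a)) * (k * (u \<bullet> a) * (v \<bullet> a))"
      by (simp only: mult_ac)
    then show ?thesis
      unfolding reflect_def k_def[symmetric] k
      by (simp add: inner_diff_left inner_diff_right inner_commute algebra_simps)
  qed (simp add: reflect_def)
  ultimately show ?thesis
    by (simp add: orthogonal_transformation_def)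
qed

lemma reflect_inner_self: "reflect a v \<bullet> a = - (v \<bullet> a)"
  by (cases "a = 0") (simp_all add: reflect_def inner_diff_left)

lemma reflect_self: "reflect a a = - a"
  by (cases "a = 0") (simp_all add: reflect_def scaleR_2)

lemma continuous_on_reflect [continuous_intros]: "continuous_on A (reflect a)"
  unfolding reflect_def[abs_def] by (intro continuous_intros)

text \<open>Averaging over the reflection in the direction \<open>a\<close> turns the correlation into the integral
  of \<open>(w v - w (reflect a v)) * (v \<bullet> a) / 2\<close>, which is pointwise nonnegative by monotonicity.\<close>

lemma gauss_monotone_weight_correlation:
  fixes w :: "'v::euclidean_space \<Rightarrow> real" and a :: 'v
  assumes w [measurable]: "w \<in> borel_measurable borel"
    and int: "integrable gauss (\<lambda>v. w v * (v \<bullet> a))"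
    and mono: "\<And>v t. 0 \<le> t \<Longrightarrow> w v \<le> w (v + t *\<^sub>R a)"
    and U: "open U" "U \<noteq> {}" "\<And>v. v \<in> U \<Longrightarrow> 0 < v \<bullet> a" "\<And>v. v \<in> U \<Longrightarrow> w (reflect a v) < w v"
  shows "0 < (\<integral>v. w v * (v \<bullet> a) \<partial>gauss)"
proof -
  have [measurable]: "reflect a \<in> borel_measurable borel"
    by (intro borel_measurable_continuous_onI continuous_intros)
  let ?f = "\<lambda>v. w v * (v \<bullet> a)"
  have "integrable (distr gauss borel (reflect a)) ?f"
    unfolding distr_gauss_orthogonal[OF orthogonal_transformation_reflect] by (rule int)
  then have int': "integrable gauss (\<lambda>v. w (reflect a v) * (v \<bullet> a))"
    by (subst (asm) integrable_distr_eq) (auto simp: reflect_inner_self)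
  have "integral\<^sup>L gauss ?f = integral\<^sup>L (distr gauss borel (reflect a)) ?f"
    unfolding distr_gauss_orthogonal[OF orthogonal_transformation_reflect] ..
  also have "\<dots> = - (\<integral>v. w (reflect a v) * (v \<bullet> a) \<partial>gauss)"
    by (subst integral_distr) (auto simp: reflect_inner_self)
  finally have "2 * integral\<^sup>L gauss ?f = (\<integral>v. (w v - w (reflect a v)) * (v \<bullet> a) \<partial>gauss)"
    using int int' by (simp add: left_diff_distrib)
  also have "\<dots> > 0"
  proof (rule integral_gauss_pos[OF _ _ U(1,2)])
    show "integrable gauss (\<lambda>v. (w v - w (reflect a v)) * (v \<bullet> a))"
      using int int' by (simp add: left_diff_distrib)
    show "0 < (w v - w (reflect a v)) * (v \<bullet> a)" if "v \<in> U" for v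
      using U(3,4)[OF that] by simp
    show "0 \<le> (w v - w (reflect a v)) * (v \<bullet> a)" for v
    proof (cases "0 \<le> v \<bullet> a")
      \<comment> \<open>Here \<open>v\<close> is its mirror image plus a nonnegative multiple of
        \<open>a\<close>; in the other case the roles of \<open>v\<close> and its mirror image are
        exchanged and both factors are nonpositive.\<close>
      case True
      then have "w (reflect a v) \<le> w (reflect a v + (2 / (a \<bullet> a) * (v \<bullet> a)) *\<^sub>R a)"
        by (intro mono) simp
      with True show ?thesis
        by (simp add: reflect_def)
    next
      case False
      then have "w v \<le> w (v + (2 / (a \<bullet> a) * (- (v \<bullet> a))) *\<^sub>R a)"
        by (intro mono mult_nonneg_nonneg) auto
      with False show ?thesis
        by (simp add: reflect_def mult_nonpos_nonpos)
    qed
  qed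
  finally show "0 < integral\<^sup>L gauss ?f"
    by simp
qed

text \<open>Collects everything needed for one template \<open>a\<close>, from properties shared by
  both weights: values between 0 and 1, monotonicity along \<open>a\<close>, and an open set
  \<open>U\<close> on which the weight strictly beats its value at the mirror image. On
  \<open>U\<close> the weight is positive, so the limiting denominator is too.\<close>

lemma (in iid_sequence) weighted_mean_gauss:
  fixes w :: "'v \<Rightarrow> real" and a :: 'v
  assumes N: "N = gauss"
    and w: "w \<in> borel_measurable borel" "\<And>v. 0 \<le> w v" "\<And>v. w v \<le> 1"
    and mono: "\<And>v t. 0 \<le> t \<Longrightarrow> w v \<le> w (v + t *\<^sub>R a)"
    and U: "open U" "U \<noteq> {}" "\<And>v. v \<in> U \<Longrightarrow> 0 < v \<bullet> a" "\<And>v. v \<in> U \<Longrightarrow> w (reflect a v) < w v"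
  shows "0 < integral\<^sup>L gauss w"
    and "integrable gauss (\<lambda>v. w v * (v \<bullet> b))"
    and "(\<lambda>m. expectation (\<lambda>\<omega>. weighted_mean w (\<lambda>i. X i \<omega>) m \<bullet> b))
     \<longlonglongrightarrow> (\<integral>v. w v * (v \<bullet> b) \<partial>gauss) / integral\<^sup>L gauss w"
    and "\<exists>c>0. (\<lambda>m. expectation (\<lambda>\<omega>. weighted_mean w (\<lambda>i. X i \<omega>) m \<bullet> a)) \<longlonglongrightarrow> c"
    and "AE \<omega> in M. \<exists>c. c \<noteq> 0 \<and> (\<lambda>m. weighted_mean w (\<lambda>i. X i \<omega>) m) \<longlonglongrightarrow> c"
proof -
  have moment: "integrable N (\<lambda>v. norm v ^ 4)"
    using integrable_gauss_norm_power4 prob_space_N by (simp add: N)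
  interpret N: prob_space "gauss :: 'v measure"
    using prob_space_N by (simp add: N)
  have "integrable gauss w"
    using w by (intro N.integrable_const_bound[where B = 1]) auto
  show p: "0 < integral\<^sup>L gauss w"
    by (rule integral_gauss_pos[OF \<open>integrable gauss w\<close> w(2) U(1,2)]) (meson U(4) w(2) order_le_less_trans)
  have int: "integrable gauss (\<lambda>v. w v * (v \<bullet> b))" for b
    using weighted_inner_integrable[OF w moment] p by (simp add: N)
  then show "integrable gauss (\<lambda>v. w v * (v \<bullet> b))" .
  have pos: "0 < (\<integral>v. w v * (v \<bullet> a) \<partial>gauss)"
    by (rule gauss_monotone_weight_correlation[OF w(1) int mono U])
  have E: "(\<lambda>m. expectation (\<lambda>\<omega>. weighted_mean w (\<lambda>i. X i \<omega>) m \<bullet> b))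
     \<longlonglongrightarrow> (\<integral>v. w v * (v \<bullet> b) \<partial>gauss) / integral\<^sup>L gauss w" for b
    using expectation_weighted_mean_tendsto[OF w moment] p by (simp add: N)
  then show "(\<lambda>m. expectation (\<lambda>\<omega>. weighted_mean w (\<lambda>i. X i \<omega>) m \<bullet> b))
     \<longlonglongrightarrow> (\<integral>v. w v * (v \<bullet> b) \<partial>gauss) / integral\<^sup>L gauss w" .
  show "\<exists>c>0. (\<lambda>m. expectation (\<lambda>\<omega>. weighted_mean w (\<lambda>i. X i \<omega>) m \<bullet> a)) \<longlonglongrightarrow> c"
    using E[of a] pos p by (intro exI[of _ "(\<integral>v. w v * (v \<bullet> a) \<partial>gauss) / integral\<^sup>L gauss w"]) simp
  define c where "c = (\<Sum>b\<in>Basis. ((\<integral>v. w v * (v \<bullet> b) \<partial>gauss) / integral\<^sup>L gauss w) *\<^sub>R b)"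
  have c: "c \<bullet> b = (\<integral>v. w v * (v \<bullet> b) \<partial>gauss) / integral\<^sup>L gauss w" if "b \<in> Basis" for b
    using that by (simp add: c_def)
  \<comment> \<open>The almost sure limit \<open>c\<close> is nonzero because its inner product with
    \<open>a\<close>, multiplied by the mean weight, is the positive correlation
    \<open>pos\<close>.\<close>
  have "(\<integral>v. w v * (v \<bullet> a) \<partial>gauss) = (\<integral>v. (\<Sum>b\<in>Basis. (w v * (v \<bullet> b)) * (a \<bullet> b)) \<partial>gauss)"
    by (subst euclidean_inner) (simp add: sum_distrib_left mult.assoc)
  also have "\<dots> = (\<Sum>b\<in>Basis. (\<integral>v. w v * (v \<bullet> b) \<partial>gauss) * (a \<bullet> b))"
    using int by simp
  also have "\<dots> = integral\<^sup>L gauss w * (c \<bullet> a)"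
    using p by (subst euclidean_inner[of c]) (simp add: c sum_distrib_left)
  finally have "c \<noteq> 0"
    using pos by auto
  have "AE \<omega> in M. \<forall>b\<in>Basis. (\<lambda>m. weighted_mean w (\<lambda>i. X i \<omega>) m \<bullet> b) \<longlonglongrightarrow> c \<bullet> b"
    using weighted_mean_tendsto_AE[OF w moment] p by (simp add: N c cong: ball_cong)
  then show "AE \<omega> in M. \<exists>c. c \<noteq> 0 \<and> (\<lambda>m. weighted_mean w (\<lambda>i. X i \<omega>) m) \<longlonglongrightarrow> c"
  proof eventually_elim
    case (elim \<omega>)
    then have "(\<lambda>m. weighted_mean w (\<lambda>i. X i \<omega>) m) \<longlonglongrightarrow> c"
      by (subst tendsto_componentwise_iff) 
    with \<open>c \<noteq> 0\<close> show ?case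
      by blast
  qed
qed

section \<open>The two estimators as weighted means, and the three claims\<close>

text \<open>The size of a cell is the sum of its indicator weights; for an empty cell both sides
  take the default value 0.\<close>

lemma hard_est_eq_weighted_mean:
  "hard_est x L ns m l = weighted_mean (\<lambda>v. of_bool (assigned x L v l)) ns m"
proof -
  have A: "{i. i < m \<and> assigned x L (ns i) l} = {i \<in> {..<m}. assigned x L (ns i) l}"
    by auto
  have "real (card {i \<in> {..<m}. assigned x L (ns i) l}) = (\<Sum>i<m. of_bool (assigned x L (ns i) l))"
    by (simp add: Int_def)
  moreover have "(\<Sum>i | i \<in> {..<m} \<and> assigned x L (ns i) l. ns i)
      = (\<Sum>i<m. of_bool (assigned x L (ns i) l) *\<^sub>R ns i)"
    by (subst sum.inter_filter) (auto intro: sum.cong)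
  ultimately show ?thesis
    unfolding hard_est_def weighted_mean_def Let_def A by simp
qed

lemma soft_est_eq_weighted_mean: "soft_est x L ns m l = weighted_mean (\<lambda>v. soft_weight x L v l) ns m"
  by (simp add: soft_est_def weighted_mean_def)

text \<open>Dividing by the numerator leaves only differences of templates, so monotonicity along
  \<open>x l\<close> can be checked term by term in the denominator.\<close>

lemma soft_weight_eq: "soft_weight x L v l = 1 / (\<Sum>r<L. exp (v \<bullet> (x r - x l)))"
  by (simp add: soft_weight_def inner_diff_right exp_diff flip: sum_divide_distrib)

text \<open>Expanding \<open>(a - b) \<bullet> (a - b) > 0\<close> with equal norms gives twice the
  claimed gap. This is where the equal norms of the templates are used.\<close>

lemma inner_less_of_norm_eq:
  fixes a b :: "'v::real_inner"
  assumes "norm a = norm b" "a \<noteq> b"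
  shows "a \<bullet> b < a \<bullet> a"
proof -
  have "0 < (a - b) \<bullet> (a - b)"
    using assms by simp
  moreover have "a \<bullet> a = b \<bullet> b"
    using assms by (simp add: norm_eq)
  ultimately show ?thesis
    by (simp add: inner_diff_left inner_diff_right inner_commute)
qed

theorem theorem1:
  fixes P :: "'w measure"
    and x :: "nat \<Rightarrow> 'v::euclidean_space"
    and n :: "nat \<Rightarrow> 'w \<Rightarrow> 'v"
    and L :: nat
  assumes "prob_space P"
    and "L \<ge> 2"
    and "inj_on x {..<L}"
    and "\<forall>l<L. norm (x l) = norm (x 0)"
    and "prob_space.indep_vars P (\<lambda>_. borel) n UNIV"
    and "\<forall>i. distributed P lborel (n i) std_gauss_density"
  shows "(\<forall>est \<in> {hard_est x L, soft_est x L}. \<forall>l<L.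
            (AE \<omega> in P. \<exists>c. c \<noteq> 0 \<and> (\<lambda>M. est (\<lambda>i. n i \<omega>) M l) \<longlonglongrightarrow> c)
          \<and> (\<exists>c>0. (\<lambda>M. \<integral>\<omega>. inner (est (\<lambda>i. n i \<omega>) M l) (x l) \<partial>P) \<longlonglongrightarrow> c))
       \<and> (\<forall>l<L. \<forall>k<L. k \<noteq> l \<longrightarrow>
            (\<exists>a b. (\<lambda>M. \<integral>\<omega>. inner (hard_est x L (\<lambda>i. n i \<omega>) M l) (x l) \<partial>P) \<longlonglongrightarrow> a
                 \<and> (\<lambda>M. \<integral>\<omega>. inner (hard_est x L (\<lambda>i. n i \<omega>) M l) (x k) \<partial>P) \<longlonglongrightarrow> b
                 \<and> a > b))"
proof -
  interpret prob_space P by fact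
  have "distr P borel (n i) = gauss" for i
  proof -
    have "distr P lborel (n i) = gauss"
      using assms(6) by (simp add: distributed_def gauss_def)
    moreover have "distr P borel (n i) = distr P lborel (n i)"
      by (rule distr_cong) auto
    ultimately show ?thesis by simp
  qed
  with assms(5) interpret iid_sequence P n gauss
    by unfold_locales
  have closer: "x l \<bullet> x r < x l \<bullet> x l" if "l < L" "r < L" "r \<noteq> l" for l r
  proof (rule inner_less_of_norm_eq)
    show "norm (x l) = norm (x r)"
      using assms(4)[rule_format, of l] assms(4)[rule_format, of r] that by linarith
    show "x l \<noteq> x r"
      using inj_onD[OF assms(3), of l r] that by auto
  qed
  have other: "\<exists>r<L. r \<noteq> l" for l
    using assms(2) by (intro exI[of _ "if l = 0 then 1 else 0"]) auto
  have nonzero: "x l \<noteq> 0" if "l < L" for l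
    using other[of l] closer[of l] that by force

  define hw where "hw l v = (of_bool (assigned x L v l) :: real)" for l v
  define sw where "sw l v = soft_weight x L v l" for l v
  \<comment> \<open>Points that strictly prefer template \<open>l\<close>, whose mirror images
    strictly prefer every other template to \<open>l\<close>. The set is open because all
    inequalities are strict, and it contains \<open>x l\<close>, whose mirror image is
    \<open>- x l\<close>.\<close>
  define HU where "HU l = (\<Inter>r\<in>{..<L} - {l}. {v. v \<bullet> x r < v \<bullet> x l} \<inter> {v. reflect (x l) v \<bullet> x l < reflect (x l) v \<bullet> x r})
      \<inter> {v. 0 < v \<bullet> x l}" for l

  \<comment> \<open>Hard assignment: the indicator weight satisfies the hypotheses on
    \<open>HU l\<close>\<close>
  have hw_meas: "hw l \<in> borel_measurable borel" for l
    unfolding hw_def[abs_def] assigned_def[abs_def] by measurable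
  have hw_mono: "hw l v \<le> hw l (v + t *\<^sub>R x l)" if "l < L" "0 \<le> t" for l v t
  proof -
    \<comment> \<open>Moving along \<open>x l\<close> raises the score of \<open>l\<close> at least
      as much as that of any other template, by \<open>closer\<close>.\<close>
    have "assigned x L (v + t *\<^sub>R x l) l" if "assigned x L v l"
      unfolding assigned_def
    proof (intro conjI allI impI)
      fix r assume "r < L" "r \<noteq> l"
      then show "(v + t *\<^sub>R x l) \<bullet> x r < (v + t *\<^sub>R x l) \<bullet> x l"
        using that closer[of l r] \<open>l < L\<close> \<open>0 \<le> t\<close>
        by (auto simp: assigned_def inner_add_left intro!: add_less_le_mono mult_left_mono)
    qed fact
    then show ?thesis
      by (simp add: hw_def)
  qed
  have HU_open: "open (HU l)" for l
    unfolding HU_def by (intro open_Int open_INT ballI open_Collect_less continuous_intros) auto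
  have HU_ne: "HU l \<noteq> {}" if "l < L" for l
  proof -
    have "x l \<in> HU l"
      using closer[OF that] nonzero[OF that] by (auto simp: HU_def reflect_self)
    then show ?thesis by blast
  qed
  have HU_assigned: "assigned x L v l" if "v \<in> HU l" "l < L" for v l
    using that by (auto simp: HU_def assigned_def)
  have HU_reflect: "hw l (reflect (x l) v) < hw l v" if "v \<in> HU l" "l < L" for v l
  proof -
    obtain r where r: "r < L" "r \<noteq> l"
      using other by blast
    then have "reflect (x l) v \<bullet> x l < reflect (x l) v \<bullet> x r"
      using that by (auto simp: HU_def)
    then have "\<not> assigned x L (reflect (x l) v) l"
      using r unfolding assigned_def by (meson less_asym)
    then show ?thesis
      using HU_assigned[OF that] by (simp add: hw_def)
  qed
  have hard: "hw l \<in> borel_measurable borel" "\<And>v. 0 \<le> hw l v" "\<And>v. hw l v \<le> 1"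
      "\<And>v t. 0 \<le> t \<Longrightarrow> hw l v \<le> hw l (v + t *\<^sub>R x l)" "open (HU l)" "HU l \<noteq> {}"
      "\<And>v. v \<in> HU l \<Longrightarrow> 0 < v \<bullet> x l" "\<And>v. v \<in> HU l \<Longrightarrow> hw l (reflect (x l) v) < hw l v"
    if "l < L" for l
    using that hw_meas hw_mono HU_open HU_ne HU_reflect by (auto simp: hw_def HU_def)

  \<comment> \<open>Soft assignment: the softmax weight satisfies the hypotheses on a
    half-space\<close>
  have sw_eq: "sw l v = 1 / (\<Sum>r<L. exp (v \<bullet> (x r - x l)))" for l v
    by (simp add: sw_def soft_weight_eq)
  have sw_sum_ge: "(\<Sum>r<L. exp (v \<bullet> (x r - x l))) \<ge> 1" if "l < L" for l v
    using that member_le_sum[of l "{..<L}" "\<lambda>r. exp (v \<bullet> (x r - x l))"] by simp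
  have sw_meas: "sw l \<in> borel_measurable borel" for l
    unfolding sw_eq[abs_def] by measurable
  have shift_le: "exp ((v + t *\<^sub>R x l) \<bullet> (x r - x l)) \<le> exp (v \<bullet> (x r - x l))"
    if "l < L" "r < L" "0 \<le> t" for l r v t
    using that closer[of l r] by (cases "r = l") (auto simp: inner_add_left inner_diff_right intro!: mult_left_mono)
  have shift_less: "exp ((v + t *\<^sub>R x l) \<bullet> (x r - x l)) < exp (v \<bullet> (x r - x l))"
    if "l < L" "r < L" "r \<noteq> l" "0 < t" for l r v t
    using that closer[of l r] by (auto simp: inner_add_left inner_diff_right)
  have sw_mono: "sw l v \<le> sw l (v + t *\<^sub>R x l)" if "l < L" "0 \<le> t" for l v t
    unfolding sw_eq using that sw_sum_ge[OF that(1)]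
    by (intro divide_left_mono sum_mono shift_le mult_pos_pos) (auto intro: less_le_trans[OF zero_less_one])
  have sw_strict: "sw l v < sw l (v + t *\<^sub>R x l)" if "l < L" "0 < t" for l v t
  proof -
    obtain r where r: "r < L" "r \<noteq> l"
      using other by blast
    have "(\<Sum>r<L. exp ((v + t *\<^sub>R x l) \<bullet> (x r - x l))) < (\<Sum>r<L. exp (v \<bullet> (x r - x l)))"
      using that r by (intro sum_strict_mono_ex1 ballI shift_le bexI[of _ r] shift_less) auto
    then show ?thesis
      unfolding sw_eq using sw_sum_ge[OF that(1)]
      by (intro divide_strict_left_mono mult_pos_pos) (auto intro: less_le_trans[OF zero_less_one])
  qed
  \<comment> \<open>The point \<open>v\<close> is its mirror image plus
    \<open>t *\<^sub>R x l\<close> with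
    \<open>t = 2 * (v \<bullet> x l) / (x l \<bullet> x l) > 0\<close>, so strict monotonicity
    applies on the whole half-space.\<close>
  have sw_reflect: "sw l (reflect (x l) v) < sw l v" if "l < L" "0 < v \<bullet> x l" for l v
    using sw_strict[of l "2 / (x l \<bullet> x l) * (v \<bullet> x l)" "reflect (x l) v"] that nonzero[of l]
    by (simp add: reflect_def)
  have soft: "sw l \<in> borel_measurable borel" "\<And>v. 0 \<le> sw l v" "\<And>v. sw l v \<le> 1"
      "\<And>v t. 0 \<le> t \<Longrightarrow> sw l v \<le> sw l (v + t *\<^sub>R x l)" "open {v. 0 < v \<bullet> x l}" "{v. 0 < v \<bullet> x l} \<noteq> {}"
      "\<And>v. v \<in> {v. 0 < v \<bullet> x l} \<Longrightarrow> 0 < v \<bullet> x l"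
      "\<And>v. v \<in> {v. 0 < v \<bullet> x l} \<Longrightarrow> sw l (reflect (x l) v) < sw l v"
    if "l < L" for l
  proof -
    show "sw l v \<le> 1" for v
      unfolding sw_eq using sw_sum_ge[OF that, of v] by (simp add: divide_le_eq)
    show "0 \<le> sw l v" for v
      unfolding sw_eq by (simp add: sum_nonneg)
    show "open {v. 0 < v \<bullet> x l}"
      by (intro open_Collect_less continuous_intros)
    have "x l \<in> {v. 0 < v \<bullet> x l}"
      using nonzero[OF that] by simp
    then show "{v. 0 < v \<bullet> x l} \<noteq> {}" by blast
  qed (use that sw_meas sw_mono sw_reflect in auto)

  have separated: "(\<integral>v. hw l v * (v \<bullet> x k) \<partial>gauss) < (\<integral>v. hw l v * (v \<bullet> x l) \<partial>gauss)"
    if "l < L" "k < L" "k \<noteq> l" for l k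
  proof -
    note limits = weighted_mean_gauss[OF refl hard[OF \<open>l < L\<close>]]
    \<comment> \<open>The integrand is nonnegative because
      \<open>v \<bullet> x l > v \<bullet> x k\<close> wherever the indicator is 1, and positive on
      the open set \<open>HU l\<close>.\<close>
    have "0 < (\<integral>v. hw l v * (v \<bullet> (x l - x k)) \<partial>gauss)"
    proof (rule integral_gauss_pos[OF limits(2) _ HU_open HU_ne])
      have *: "0 < v \<bullet> (x l - x k)" if "assigned x L v l" for v
        using that \<open>k < L\<close> \<open>k \<noteq> l\<close> by (auto simp: assigned_def inner_diff_right)
      then show "0 \<le> hw l v * (v \<bullet> (x l - x k))" for v
        by (simp add: hw_def less_imp_le)
      show "0 < hw l v * (v \<bullet> (x l - x k))" if "v \<in> HU l" for v
        using HU_assigned[OF that \<open>l < L\<close>] * by (simp add: hw_def)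
    qed (use \<open>l < L\<close> in auto)
    also have "\<dots> = (\<integral>v. hw l v * (v \<bullet> x l) \<partial>gauss) - (\<integral>v. hw l v * (v \<bullet> x k) \<partial>gauss)"
      using limits(2) by (simp add: inner_diff_right right_diff_distrib)
    finally show ?thesis by simp
  qed

  show ?thesis
  proof (intro conjI ballI allI impI)
    fix est l assume est: "est \<in> {hard_est x L, soft_est x L}" and l: "l < L"
    then consider "\<And>ns m. est ns m l = weighted_mean (hw l) ns m" | "\<And>ns m. est ns m l = weighted_mean (sw l) ns m"
      by (auto simp: hard_est_eq_weighted_mean soft_est_eq_weighted_mean hw_def[abs_def] sw_def[abs_def])
    note cases = this
    note limits = weighted_mean_gauss(4,5)[OF refl hard[OF l]] weighted_mean_gauss(4,5)[OF refl soft[OF l]]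
    show "AE \<omega> in P. \<exists>c. c \<noteq> 0 \<and> (\<lambda>M. est (\<lambda>i. n i \<omega>) M l) \<longlonglongrightarrow> c"
      by (cases rule: cases) (use limits in simp_all)
    show "\<exists>c>0. (\<lambda>M. \<integral>\<omega>. inner (est (\<lambda>i. n i \<omega>) M l) (x l) \<partial>P) \<longlonglongrightarrow> c"
      by (cases rule: cases) (use limits in simp_all)
  next
    fix l k assume l: "l < L" and k: "k < L" "k \<noteq> l"
    have est: "hard_est x L ns m l = weighted_mean (hw l) ns m" for ns m
      by (simp add: hard_est_eq_weighted_mean hw_def[abs_def])
    note limits = weighted_mean_gauss[OF refl hard[OF l]]
    show "\<exists>a b. (\<lambda>M. \<integral>\<omega>. inner (hard_est x L (\<lambda>i. n i \<omega>) M l) (x l) \<partial>P) \<longlonglongrightarrow> a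
                 \<and> (\<lambda>M. \<integral>\<omega>. inner (hard_est x L (\<lambda>i. n i \<omega>) M l) (x k) \<partial>P) \<longlonglongrightarrow> b
                 \<and> a > b"
      unfolding est
      using limits(3)[of "x l"] limits(3)[of "x k"]
        divide_strict_right_mono[OF separated[OF l k] limits(1)]
      by blast
  qed
qed

end
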